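(* Let $1\le m\le n$ be integers. Consider any ordinal matching problem instance with $n$ agents and $n$ items and any metric $d$ consistent with it. If $M$ is the (random) matching output by the mechanism TruncatedRSD with parameter $m$, then $$\mathbb{E}[\mathrm{cost}_d(M)]\ \le\ \frac{m}{n+1-m}\cdot\mathrm{cost}_d(M_{\mathrm{OPT}}),$$ where $M_{\mathrm{OPT}}$ is a minimum-cost perfect matching with respect to $d$.
   Context: Agents $A=\{a_1,\dots,a_n\}$ and items $B=\{b_1,\dots,b_n\}$. A metric is a function $d:(A\cup B)\times(A\cup B)\to\mathbb{R}_{\ge 0}$ with $d(x,x)=0$, $d(x,y)=d(y,x)$ and $d(x,y)\le d(x,z)+d(z,y)$ (distinct points are allowed to be at distance $0$). An ordinal matching problem instance consists of $n$ preference lists, one per agent; each list is a permutation of $B$. A metric $d$ is consistent with the instance if, for every agent $a_i$, whenever $b_j$ appears before $b_k$ in the list of $a_i$ we have $d(a_i,b_j)\le d(a_i,b_k)$. A (not necessarily perfect) matching $M$ is a set of agent-item pairs in which each agent and each item appears at most once; $\mathrm{cost}_d(M)=\sum_{(a,b)\in M}d(a,b)$. A perfect matching has $n$ pairs. TruncatedRSD with parameter $m$: start with an empty matching. While fewer than $m$ agents are matched: pick an agent $a_i$ uniformly at random from all unmatched agents, and match $a_i$ to their most preferred unmatched item (the first unmatched item on their list). Output the resulting matching of size $m$. *)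

theory Defs
  imports "HOL-Probability.Probability"
begin

text \<open>A metric in the sense used here is a pseudometric: distinct points may be at distance 0,
  so the library's \<open>Metric_space\<close> locale does not apply. Values of \<open>d\<close> outside \<open>S\<close> are irrelevant.\<close>

definition metric_on :: "'v set \<Rightarrow> ('v \<Rightarrow> 'v \<Rightarrow> real) \<Rightarrow> bool" where
  "metric_on S d \<longleftrightarrow>
     (\<forall>x\<in>S. \<forall>y\<in>S. 0 \<le> d x y) \<and>
     (\<forall>x\<in>S. d x x = 0) \<and>
     (\<forall>x\<in>S. \<forall>y\<in>S. d x y = d y x) \<and>
     (\<forall>x\<in>S. \<forall>y\<in>S. \<forall>z\<in>S. d x y \<le> d x z + d z y)"

definition ordinal_instance :: "nat \<Rightarrow> 'v set \<Rightarrow> 'v set \<Rightarrow> ('v \<Rightarrow> 'v list) \<Rightarrow> bool" where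
  "ordinal_instance n A B pref \<longleftrightarrow>
     finite A \<and> card A = n \<and> finite B \<and> card B = n \<and> A \<inter> B = {} \<and>
     (\<forall>a\<in>A. distinct (pref a) \<and> set (pref a) = B)"

definition consistent :: "'v set \<Rightarrow> ('v \<Rightarrow> 'v list) \<Rightarrow> ('v \<Rightarrow> 'v \<Rightarrow> real) \<Rightarrow> bool" where
  "consistent A pref d \<longleftrightarrow> (\<forall>a\<in>A. sorted_wrt (\<lambda>b c. d a b \<le> d a c) (pref a))"

definition matching :: "'v set \<Rightarrow> 'v set \<Rightarrow> ('v \<times> 'v) set \<Rightarrow> bool" where
  "matching A B M \<longleftrightarrow> M \<subseteq> A \<times> B \<and> inj_on fst M \<and> inj_on snd M"

definition perfect_matching :: "'v set \<Rightarrow> 'v set \<Rightarrow> ('v \<times> 'v) set \<Rightarrow> bool" where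
  "perfect_matching A B M \<longleftrightarrow> matching A B M \<and> card M = card A"

definition cost :: "('v \<Rightarrow> 'v \<Rightarrow> real) \<Rightarrow> ('v \<times> 'v) set \<Rightarrow> real" where
  "cost d M = (\<Sum>(a, b)\<in>M. d a b)"

definition top_unmatched :: "('v \<Rightarrow> 'v list) \<Rightarrow> ('v \<times> 'v) set \<Rightarrow> 'v \<Rightarrow> 'v" where
  "top_unmatched pref M a = hd (filter (\<lambda>b. b \<notin> snd ` M) (pref a))"

text \<open>Each pass through the loop matches exactly one further agent, so looping while fewer than
  \<open>m\<close> agents are matched means performing \<open>m\<close> rounds. For \<open>m \<le> card A = card B\<close>
  every call of \<open>pmf_of_set\<close> and \<open>hd\<close> is on a nonempty argument.\<close>

primrec truncated_rsd ::
  "'v set \<Rightarrow> ('v \<Rightarrow> 'v list) \<Rightarrow> nat \<Rightarrow> ('v \<times> 'v) set pmf" where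
  "truncated_rsd A pref 0 = return_pmf {}"
| "truncated_rsd A pref (Suc m) =
     do {
       M \<leftarrow> truncated_rsd A pref m;
       a \<leftarrow> pmf_of_set (A - fst ` M);
       return_pmf (insert (a, top_unmatched pref M a) M)
     }"

end

(* Exchange argument: when a takes b, giving the former owner of b the item that was planned
   for a raises the cost of a plan for the unmatched agents and items by at most d(a,b), by the
   triangle inequality. So after k rounds the unmatched agents and items admit a perfect
   matching of cost at most OPT + cost(M_k). A uniformly random agent pays at most what it would
   pay in this matching, hence
   E[cost(M_(k+1))] <= E[cost(M_k)] + (OPT + E[cost(M_k)]) / (n - k),
   and k / (n + 1 - k) * OPT solves this recursion with equality. *)
theory Submission
  imports Defs
begin

text \<open>Finite supports reduce both sides to the same weighted finite sum. This allows a round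
  to be averaged conditionally on the matching that precedes it.\<close>

lemma expectation_bind_pmf_finite:
  fixes h :: "'b \<Rightarrow> real"
  assumes "finite (set_pmf p)" "\<And>x. x \<in> set_pmf p \<Longrightarrow> finite (set_pmf (f x))"
  shows "measure_pmf.expectation (bind_pmf p f) h
    = measure_pmf.expectation p (\<lambda>x. measure_pmf.expectation (f x) h)"
proof -
  have "measure_pmf.expectation (bind_pmf p f) h
      = (\<Sum>x\<in>set_pmf p. pmf p x *\<^sub>R measure_pmf.expectation (f x) h)"
    using assms by (intro pmf_expectation_bind) auto
  also have "\<dots> = measure_pmf.expectation p (\<lambda>x. measure_pmf.expectation (f x) h)"
    using assms(1) by (intro integral_measure_pmf[symmetric]) (auto simp: set_pmf_iff)
  finally show ?thesis .
qed

text \<open>The exchange is a function update, so a set of pairs is first turned into a bijection.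
  Equal cardinalities force both projections to be onto; the bijection is \<open>snd\<close> after
  the inverse of \<open>fst\<close>.\<close>

lemma perfect_matching_bij_betw:
  assumes "perfect_matching A B M" "finite A" "finite B" "card A = card B"
  obtains f where "bij_betw f A B" "(\<Sum>a\<in>A. d a (f a)) = cost d M"
proof -
  have sub: "M \<subseteq> A \<times> B" and inj: "inj_on fst M" "inj_on snd M" and card: "card M = card A"
    using assms(1) by (auto simp: perfect_matching_def matching_def)
  have sub': "fst ` M \<subseteq> A" "snd ` M \<subseteq> B"
    using sub by auto
  have fst: "bij_betw fst M A"
    using card_subset_eq[of A "fst ` M"] assms(2) sub'(1) inj(1) card
    by (simp add: bij_betw_def card_image)
  have snd: "bij_betw snd M B"
    using card_subset_eq[of B "snd ` M"] assms(3,4) sub'(2) inj(2) card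
    by (simp add: bij_betw_def card_image)
  let ?g = "inv_into M fst"
  have g: "bij_betw ?g A M"
    using fst by (rule bij_betw_inv_into)
  have "(\<Sum>a\<in>A. d a (snd (?g a))) = (\<Sum>a\<in>A. d (fst (?g a)) (snd (?g a)))"
    using bij_betw_inv_into_right[OF fst] by (intro sum.cong) auto
  also have "\<dots> = (\<Sum>p\<in>M. d (fst p) (snd p))"
    by (rule sum.reindex_bij_betw[OF g])
  also have "\<dots> = cost d M"
    by (simp add: cost_def case_prod_beta)
  finally show thesis
    using that[of "snd \<circ> ?g"] bij_betw_trans[OF g snd] by simp
qed

lemma bij_betw_remove_pair:
  fixes d :: "'v \<Rightarrow> 'v \<Rightarrow> real"
  assumes "metric_on S d" "U \<subseteq> S" "V \<subseteq> S" "finite U"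
    and f: "bij_betw f U V" and a: "a \<in> U" and b: "b \<in> V"
  obtains g where "bij_betw g (U - {a}) (V - {b})"
    "(\<Sum>x\<in>U - {a}. d x (g x)) \<le> (\<Sum>x\<in>U. d x (f x)) + d a b"
proof -
  note metric = assms(1)[unfolded metric_on_def]
  obtain a' where a': "a' \<in> U" "f a' = b"
    using f b by (auto simp: bij_betw_def)
  have fa: "f a \<in> V"
    using f a by (auto simp: bij_betw_def)
  let ?g = "f(a' := f a)"
  show thesis
  proof (rule that)
    show "bij_betw ?g (U - {a}) (V - {b})"
      using f a a' by (auto simp: bij_betw_def inj_on_def)
    show "(\<Sum>x\<in>U - {a}. d x (?g x)) \<le> (\<Sum>x\<in>U. d x (f x)) + d a b"
    \<comment> \<open>If \<open>a\<close> itself owned \<open>b\<close>, the update changes nothing: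
      one summand is dropped, and nonnegativity of \<open>d\<close> gives the bound.\<close>
    proof (cases "a' = a")
      case True
      then have "(\<Sum>x\<in>U - {a}. d x (?g x)) = (\<Sum>x\<in>U - {a}. d x (f x))"
        by (intro sum.cong) auto
      moreover have "(\<Sum>x\<in>U. d x (f x)) = d a b + (\<Sum>x\<in>U - {a}. d x (f x))"
        using \<open>finite U\<close> a a' True by (subst sum.remove[of U a]) auto
      moreover have "0 \<le> d a b"
        using metric a b assms(2,3) by blast
      ultimately show ?thesis by linarith
    next
      case False
      let ?W = "U - {a} - {a'}"
      have "(\<Sum>x\<in>U - {a}. d x (?g x)) = d a' (f a) + (\<Sum>x\<in>?W. d x (?g x))"
        using \<open>finite U\<close> a a' False by (subst sum.remove[of "U - {a}" a']) auto
      also have "(\<Sum>x\<in>?W. d x (?g x)) = (\<Sum>x\<in>?W. d x (f x))"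
        by (intro sum.cong) auto
      finally have "(\<Sum>x\<in>U - {a}. d x (?g x)) = d a' (f a) + (\<Sum>x\<in>?W. d x (f x))" .
      moreover have "(\<Sum>x\<in>U. d x (f x)) = d a (f a) + (d a' b + (\<Sum>x\<in>?W. d x (f x)))"
        using \<open>finite U\<close> a a' False sum.remove[of U a "\<lambda>x. d x (f x)"]
          sum.remove[of "U - {a}" a' "\<lambda>x. d x (f x)"] by auto
      \<comment> \<open>Go from \<open>a'\<close> to \<open>f a\<close> through \<open>b\<close> and
        then \<open>a\<close>. The outer legs are exactly the summands of \<open>a'\<close> and
        \<open>a\<close> in the old sum, so the excess is \<open>d a b\<close>.\<close>
      moreover have "d a' (f a) \<le> d a' b + d b (f a)" "d b (f a) \<le> d b a + d a (f a)"
          "d b a = d a b"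
        using metric a b a'(1) fa assms(2,3) by (meson subsetD)+
      ultimately show ?thesis by linarith
    qed
  qed
qed

text \<open>The free item \<open>b\<close> keeps the filtered list nonempty, so that
  \<open>hd\<close> is meaningful; filtering preserves sortedness, so the head is a nearest free
  item.\<close>

lemma top_unmatched_best:
  assumes "consistent A pref d" "a \<in> A" "set (pref a) = B" "b \<in> B - snd ` M"
  shows "top_unmatched pref M a \<in> B - snd ` M" "d a (top_unmatched pref M a) \<le> d a b"
proof -
  let ?F = "filter (\<lambda>b. b \<notin> snd ` M) (pref a)"
  have set_F: "set ?F = B - snd ` M"
    using assms(3) by auto
  then obtain c cs where F: "?F = c # cs"
    using assms(4) by (cases ?F) auto
  then have top: "top_unmatched pref M a = c"
    by (simp add: top_unmatched_def)
  show "top_unmatched pref M a \<in> B - snd ` M"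
    using set_F by (auto simp: top F)
  have "sorted_wrt (\<lambda>b c. d a b \<le> d a c) ?F"
    using assms(1,2) by (auto simp: consistent_def intro: sorted_wrt_filter)
  then show "d a (top_unmatched pref M a) \<le> d a b"
    using assms(4) set_F by (auto simp: top F)
qed

text \<open>Loop invariant, valid for every outcome and not just on average: each exchange adds at
  most the price just paid, and these prices sum to \<open>cost d M\<close>. The cardinality
  guarantees that the next draw is from a nonempty set.\<close>

lemma truncated_rsd_residual_matching:
  assumes "ordinal_instance n A B pref" "metric_on (A \<union> B) d" "consistent A pref d"
    and "perfect_matching A B M_opt" "k \<le> n" "M \<in> set_pmf (truncated_rsd A pref k)"
  shows "finite M \<and> card (A - fst ` M) = n - k \<and>
    (\<exists>f. bij_betw f (A - fst ` M) (B - snd ` M) \<and>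
         (\<Sum>a\<in>A - fst ` M. d a (f a)) \<le> cost d M_opt + cost d M)"
  using assms(5,6)
proof (induction k arbitrary: M)
  case 0
  then have "M = {}" by simp
  moreover obtain f where "bij_betw f A B" "(\<Sum>a\<in>A. d a (f a)) = cost d M_opt"
    using perfect_matching_bij_betw[OF assms(4)] assms(1) by (metis ordinal_instance_def)
  ultimately show ?case
    using assms(1) by (auto simp: ordinal_instance_def cost_def)
next
  case (Suc k)
  note inst = assms(1)[unfolded ordinal_instance_def]
  from Suc.prems(2) obtain N where N: "N \<in> set_pmf (truncated_rsd A pref k)"
    and M': "M \<in> set_pmf (pmf_of_set (A - fst ` N) \<bind>
        (\<lambda>a. return_pmf (insert (a, top_unmatched pref N a) N)))"
    by auto
  let ?U = "A - fst ` N" and ?V = "B - snd ` N"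
  from Suc.IH[OF _ N] Suc.prems(1) obtain f where finN: "finite N" and card: "card ?U = n - k"
    and f: "bij_betw f ?U ?V" and le: "(\<Sum>a\<in>?U. d a (f a)) \<le> cost d M_opt + cost d N"
    by auto
  have U: "finite ?U" "?U \<noteq> {}"
    using card Suc.prems(1) card_gt_0_iff[of ?U] by auto
  with M' obtain a where a: "a \<in> ?U" and M: "M = insert (a, top_unmatched pref N a) N"
    by (auto simp: set_pmf_of_set)
  let ?b = "top_unmatched pref N a"
  \<comment> \<open>The planned item \<open>f a\<close> witnesses that \<open>a\<close> still has a
    free item.\<close>
  have b: "?b \<in> ?V"
    using top_unmatched_best(1)[OF assms(3), of a B "f a" N] a inst f by (auto simp: bij_betw_def)
  obtain g where g: "bij_betw g (?U - {a}) (?V - {?b})"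
      and g_le: "(\<Sum>x\<in>?U - {a}. d x (g x)) \<le> (\<Sum>x\<in>?U. d x (f x)) + d a ?b"
    using bij_betw_remove_pair[OF assms(2) _ _ U(1) f a b] by blast
  \<comment> \<open>The pair is new, so inserting it really adds its cost.\<close>
  have "(a, ?b) \<notin> N"
    using a by force
  then have cost_M: "cost d M = d a ?b + cost d N"
    using finN by (simp add: M cost_def)
  have sets: "A - fst ` M = ?U - {a}" "B - snd ` M = ?V - {?b}"
    by (auto simp: M)
  have "card (?U - {a}) = n - Suc k"
    using card a by simp
  moreover have "(\<Sum>x\<in>?U - {a}. d x (g x)) \<le> cost d M_opt + cost d M"
    using g_le le cost_M by linarith
  ultimately show ?case
    using g finN unfolding sets by (auto simp: M)
qed

text \<open>Each round branches over a finite nonempty set of agents. Finiteness supplies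
  integrability and the conditioning step later.\<close>

lemma finite_set_pmf_truncated_rsd:
  assumes "ordinal_instance n A B pref" "metric_on (A \<union> B) d" "consistent A pref d"
    and "perfect_matching A B M_opt" "k \<le> n"
  shows "finite (set_pmf (truncated_rsd A pref k))"
  using assms(5)
proof (induction k)
  case (Suc k)
  have "finite (set_pmf (pmf_of_set (A - fst ` M)))"
    if "M \<in> set_pmf (truncated_rsd A pref k)" for M
  proof -
    have "card (A - fst ` M) = n - k"
      using truncated_rsd_residual_matching[OF assms(1-4) _ that] Suc.prems by auto
    then have "finite (A - fst ` M)" "A - fst ` M \<noteq> {}"
      using Suc.prems card_gt_0_iff[of "A - fst ` M"] by auto
    then show ?thesis by (simp add: set_pmf_of_set)
  qed
  with Suc show ?case by auto
qed simp

text \<open>Favourites of different remaining agents may coincide, yet each is no farther from its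
  agent than the planned partner, so their total is bounded by the cost of the residual
  plan.\<close>

lemma expected_cost_round:
  assumes "ordinal_instance n A B pref" "metric_on (A \<union> B) d" "consistent A pref d"
    and "perfect_matching A B M_opt" "k < n" "M \<in> set_pmf (truncated_rsd A pref k)"
  shows "measure_pmf.expectation (pmf_of_set (A - fst ` M))
           (\<lambda>a. cost d (insert (a, top_unmatched pref M a) M))
         \<le> cost d M + (cost d M_opt + cost d M) / (real n - real k)"
proof -
  let ?U = "A - fst ` M" and ?V = "B - snd ` M" and ?b = "top_unmatched pref M"
  note inst = assms(1)[unfolded ordinal_instance_def]
  from truncated_rsd_residual_matching[OF assms(1-4) _ assms(6)] \<open>k < n\<close> obtain f
    where finM: "finite M" and card: "card ?U = n - k" and f: "bij_betw f ?U ?V"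
      and le: "(\<Sum>a\<in>?U. d a (f a)) \<le> cost d M_opt + cost d M"
    by auto
  have U: "finite ?U" "?U \<noteq> {}"
    using card \<open>k < n\<close> card_gt_0_iff[of ?U] by auto
  have card': "real (card ?U) = real n - real k"
    using card \<open>k < n\<close> by (simp add: of_nat_diff)
  have cost: "cost d (insert (a, ?b a) M) = d a (?b a) + cost d M" if "a \<in> ?U" for a
  proof -
    have "(a, ?b a) \<notin> M"
      using that by force
    then show ?thesis
      using finM by (simp add: cost_def)
  qed
  have "measure_pmf.expectation (pmf_of_set ?U) (\<lambda>a. cost d (insert (a, ?b a) M))
      = (\<Sum>a\<in>?U. cost d (insert (a, ?b a) M)) / real (card ?U)"
    using U by (simp add: integral_pmf_of_set)
  also have "(\<Sum>a\<in>?U. cost d (insert (a, ?b a) M)) = (\<Sum>a\<in>?U. d a (?b a) + cost d M)"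
    by (intro sum.cong refl cost)
  also have "\<dots> = (\<Sum>a\<in>?U. d a (?b a)) + real (card ?U) * cost d M"
    by (simp add: sum.distrib)
  also have "\<dots> / real (card ?U) = cost d M + (\<Sum>a\<in>?U. d a (?b a)) / real (card ?U)"
    using U by (simp add: add_divide_distrib)
  also have "\<dots> \<le> cost d M + (cost d M_opt + cost d M) / real (card ?U)"
  proof -
    have "d a (?b a) \<le> d a (f a)" if "a \<in> ?U" for a
      using top_unmatched_best(2)[OF assms(3), of a B "f a" M] that inst f
      by (auto simp: bij_betw_def)
    then have "(\<Sum>a\<in>?U. d a (?b a)) \<le> (\<Sum>a\<in>?U. d a (f a))"
      by (rule sum_mono)
    with le show ?thesis
      by (intro add_left_mono divide_right_mono) auto
  qed
  finally show ?thesis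
    unfolding card' .
qed

text \<open>The bound for one round is affine in \<open>cost d M\<close>, so averaging it over
  \<open>M\<close> leaves an expression in \<open>E k\<close> alone.\<close>

lemma expected_cost_Suc:
  assumes "ordinal_instance n A B pref" "metric_on (A \<union> B) d" "consistent A pref d"
    and "perfect_matching A B M_opt" "k < n"
  defines "E \<equiv> \<lambda>k. measure_pmf.expectation (truncated_rsd A pref k) (cost d)"
  shows "E (Suc k) \<le> E k + (cost d M_opt + E k) / (real n - real k)"
proof -
  let ?p = "truncated_rsd A pref k"
  let ?q = "\<lambda>M. pmf_of_set (A - fst ` M)"
  let ?F = "\<lambda>M a. insert (a, top_unmatched pref M a) M"
  note fin = finite_set_pmf_truncated_rsd[OF assms(1-4)]
  have fin_p: "finite (set_pmf ?p)"
    using \<open>k < n\<close> by (intro fin) simp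
  have int: "integrable (measure_pmf ?p) g" for g :: "('a \<times> 'a) set \<Rightarrow> real"
    using fin_p by (rule integrable_measure_pmf_finite)
  have fin_Suc: "finite (set_pmf (truncated_rsd A pref (Suc k)))"
    using \<open>k < n\<close> by (intro fin) simp
  have "E (Suc k) = measure_pmf.expectation (?p \<bind> (\<lambda>M. map_pmf (?F M) (?q M))) (cost d)"
    by (simp add: E_def map_pmf_def)
  also have "\<dots> = measure_pmf.expectation ?p
      (\<lambda>M. measure_pmf.expectation (map_pmf (?F M) (?q M)) (cost d))"
  proof (rule expectation_bind_pmf_finite[OF fin_p])
    fix M assume "M \<in> set_pmf ?p"
    then have "set_pmf (map_pmf (?F M) (?q M)) \<subseteq> set_pmf (truncated_rsd A pref (Suc k))"
      by (auto simp: map_pmf_def)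
    then show "finite (set_pmf (map_pmf (?F M) (?q M)))"
      using fin_Suc finite_subset by blast
  qed
  also have "\<dots> = measure_pmf.expectation ?p
      (\<lambda>M. measure_pmf.expectation (?q M) (\<lambda>a. cost d (?F M a)))"
    by simp
  \<comment> \<open>The bound for one round is available on the support only, hence monotonicity
    almost everywhere.\<close>
  also have "\<dots> \<le> measure_pmf.expectation ?p
      (\<lambda>M. cost d M + (cost d M_opt + cost d M) / (real n - real k))"
    using expected_cost_round[OF assms(1-5)]
    by (intro integral_mono_AE int) (simp add: AE_measure_pmf_iff)
  also have "\<dots> = E k + (cost d M_opt + E k) / (real n - real k)"
    by (simp add: E_def int Bochner_Integration.integral_add)
  finally show ?thesis .
qed

theorem mainTheorem7:
  fixes m n :: nat and A B :: "'v set" and pref :: "'v \<Rightarrow> 'v list"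
    and d :: "'v \<Rightarrow> 'v \<Rightarrow> real" and M_opt :: "('v \<times> 'v) set"
  assumes "1 \<le> m" and "m \<le> n"
    and "ordinal_instance n A B pref"
    and "metric_on (A \<union> B) d"
    and "consistent A pref d"
    and "is_arg_min (cost d) (perfect_matching A B) M_opt"
  shows "measure_pmf.expectation (truncated_rsd A pref m) (cost d)
           \<le> real m / (real n + 1 - real m) * cost d M_opt"
proof -
  have opt: "perfect_matching A B M_opt"
    using assms(6) by (simp add: is_arg_min_def)
  let ?E = "\<lambda>k. measure_pmf.expectation (truncated_rsd A pref k) (cost d)"
  show ?thesis
    using \<open>m \<le> n\<close>
  \<comment> \<open>Starting at 0 anchors the recursion at the empty matching, of cost 0.\<close>
  proof (induction m)
    case 0
    then show ?case by (simp add: cost_def)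
  next
    case (Suc k)
    \<comment> \<open>\<open>r\<close> counts the agents still unmatched before the round; the
      denominators before and after it become \<open>r + 1\<close> and \<open>r\<close>.\<close>
    define r where "r = real n - real k"
    have r: "r > 0" and k: "real k = real n - r"
      using Suc.prems by (auto simp: r_def)
    let ?c = "cost d M_opt"
    have IH: "?E k \<le> real k / (r + 1) * ?c"
      using Suc by (simp add: r_def algebra_simps)
    have "?E (Suc k) \<le> ?E k + (?c + ?E k) / r"
      using expected_cost_Suc[OF assms(3-5) opt] Suc.prems by (simp add: r_def)
    also have "\<dots> \<le> real k / (r + 1) * ?c + (?c + real k / (r + 1) * ?c) / r"
      using IH r by (intro add_mono divide_right_mono) auto
    \<comment> \<open>Over the common denominator \<open>r * (r + 1)\<close> the numerator is
      \<open>k * r + r + 1 + k = (k + 1) * (r + 1)\<close>, and \<open>r + 1\<close>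
      cancels.\<close>
    also have "\<dots> = (real k + 1) / r * ?c"
      using r by (simp add: divide_simps) (simp add: algebra_simps)
    also have "\<dots> = real (Suc k) / (real n + 1 - real (Suc k)) * ?c"
      by (simp add: r_def algebra_simps)
    finally show ?case .
  qed
qed

end
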